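(* Let $f:\mathbf{R}^N\to\mathbf{R}$ be of the form $f(x)=\sum_{J\in\mathcal{J}} f_J(x)$, where $\mathcal{J}$ is a collection of subsets of $[n]$, each $f_J$ is convex and depends on $x$ only through the blocks $x^{(i)}$, $i\in J$, and suppose that the gradient of $f$ is block Lipschitz with positive constants $L_1,\dots,L_n$, i.e. $\|\nabla_i f(x+U_i t)-\nabla_i f(x)\|_{(i)}^*\le L_i\|t\|_{(i)}$ for all $x\in\mathbf{R}^N$, $i\in[n]$, $t\in\mathbf{R}^{N_i}$. Let $\hat Z$ be a $(C,\tau)$-distributed sampling associated with a balanced partition $P^{(1)},\dots,P^{(C)}$ of $[n]$ into $C$ sets of size $s=n/C$, where $\tau\in\{1,\dots,s\}$. Let $$\xi := \max\{|P^{(c)}\cap J| : c\in\{1,\dots,C\},\ J\in\mathcal{J}\}.$$ Then $(f,\hat Z)$ admits an ESO with parameters $$\beta = 1+\frac{(\xi-1)(\tau-1)}{\max\{1,s-1\}}+(C-1)\frac{\xi\tau}{s},\qquad w_i=L_i,\quad i=1,2,\dots,n;$$ that is, for all $x,h\in\mathbf{R}^N$, $$\mathbf{E}\big[f(x+h_{[\hat Z]})\big]\le f(x)+\frac{\mathbf{E}[|\hat Z|]}{n}\left(\langle\nabla f(x),h\rangle+\frac{\beta}{2}\|h\|_w^2\right).$$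
   Context: Block structure: $[n]=\{1,\dots,n\}$. The $N\times N$ identity matrix $U$ is decomposed by columns as $U=[U_1,\dots,U_n]$ with $U_i$ of size $N\times N_i$ and $\sum_{i=1}^n N_i=N$. For $x\in\mathbf{R}^N$, $x^{(i)}=U_i^Tx\in\mathbf{R}^{N_i}$ is block $i$ of $x$, so $x=\sum_i U_i x^{(i)}$. The block gradient is $\nabla_i f(x)=U_i^T\nabla f(x)$. For $S\subseteq[n]$ and $h\in\mathbf{R}^N$, $h_{[S]}:=\sum_{i\in S}U_i h^{(i)}$ (equal to $0$ if $S=\emptyset$). Norms: each $\mathbf{R}^{N_i}$ carries a norm $\|\cdot\|_{(i)}$ with conjugate norm $\|t\|_{(i)}^*=\max_{\|s\|_{(i)}\le1}\langle s,t\rangle$. For $w\in\mathbf{R}^n$ with positive entries, $\|x\|_w=\big(\sum_{i=1}^n w_i\|x^{(i)}\|_{(i)}^2\big)^{1/2}$. $(C,\tau)$-distributed sampling: $[n]$ is partitioned into $C$ pairwise disjoint sets $P^{(1)},\dots,P^{(C)}$, each of size $s=n/C$. For each $c$, $\hat Z^{(c)}$ is a random subset of $P^{(c)}$ of cardinality $\tau$, chosen uniformly among all subsets of $P^{(c)}$ of cardinality $\tau$, with the choices for different $c$ independent. Then $\hat Z=\bigcup_{c=1}^C\hat Z^{(c)}$. ESO (expected separable overapproximation): $(f,\hat Z)$ admits an ESO with parameters $\beta>0$ and $w\in\mathbf{R}^n_{>0}$ if the last displayed inequality of the claim holds for all $x,h\in\mathbf{R}^N$. *)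

theory Defs
  imports "HOL-Probability.Probability"
begin

(* A block structure on R^N = real ^ 'd is a map blk :: 'd => nat that sends each coordinate to
   the number of its block; N_i is the number of coordinates k with blk k = i.  The columns of
   U_i are the unit vectors axis k 1 with blk k = i.  The space R^(N_i) is identified, through
   t |-> U_i t, with the coordinate subspace block_space blk i.  Under this identification
   U_i is the inclusion, U_i^T is block_part blk i, and inner products are preserved. *)

definition block_space :: "('d::finite \<Rightarrow> nat) \<Rightarrow> nat \<Rightarrow> (real ^ 'd) set" where
  "block_space blk i = {t. \<forall>k. blk k \<noteq> i \<longrightarrow> t $ k = 0}"

definition block_part :: "('d::finite \<Rightarrow> nat) \<Rightarrow> nat \<Rightarrow> real ^ 'd \<Rightarrow> real ^ 'd" where
  "block_part blk i x = (\<chi> k. if blk k = i then x $ k else 0)"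

definition restrict_blocks :: "('d::finite \<Rightarrow> nat) \<Rightarrow> nat set \<Rightarrow> real ^ 'd \<Rightarrow> real ^ 'd" where
  "restrict_blocks blk S h = (\<Sum>i\<in>S. block_part blk i h)"

definition is_norm_on :: "'a::real_vector set \<Rightarrow> ('a \<Rightarrow> real) \<Rightarrow> bool" where
  "is_norm_on V p \<longleftrightarrow>
     (\<forall>t\<in>V. 0 \<le> p t \<and> (p t = 0 \<longleftrightarrow> t = 0)) \<and>
     (\<forall>t\<in>V. \<forall>c. p (c *\<^sub>R t) = \<bar>c\<bar> * p t) \<and>
     (\<forall>s\<in>V. \<forall>t\<in>V. p (s + t) \<le> p s + p t)"

(* The supremum is attained when p is a norm on a subspace V of a finite-dimensional space. *)
definition conj_norm :: "'a::real_inner set \<Rightarrow> ('a \<Rightarrow> real) \<Rightarrow> 'a \<Rightarrow> real" where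
  "conj_norm V p t = (SUP s\<in>{s \<in> V. p s \<le> 1}. s \<bullet> t)"

definition weighted_norm ::
    "nat \<Rightarrow> ('d::finite \<Rightarrow> nat) \<Rightarrow> (nat \<Rightarrow> real ^ 'd \<Rightarrow> real) \<Rightarrow> (nat \<Rightarrow> real) \<Rightarrow> real ^ 'd \<Rightarrow> real" where
  "weighted_norm n blk p w x = sqrt (\<Sum>i=1..n. w i * (p i (block_part blk i x))\<^sup>2)"

definition depends_only_on_blocks ::
    "('d::finite \<Rightarrow> nat) \<Rightarrow> nat set \<Rightarrow> (real ^ 'd \<Rightarrow> real) \<Rightarrow> bool" where
  "depends_only_on_blocks blk J \<phi> \<longleftrightarrow>
     (\<forall>x y. (\<forall>i\<in>J. block_part blk i x = block_part blk i y) \<longrightarrow> \<phi> x = \<phi> y)"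

(* g is the gradient of f. *)
definition block_lipschitz_gradient ::
    "nat \<Rightarrow> ('d::finite \<Rightarrow> nat) \<Rightarrow> (nat \<Rightarrow> real ^ 'd \<Rightarrow> real) \<Rightarrow> (nat \<Rightarrow> real)
       \<Rightarrow> (real ^ 'd \<Rightarrow> real ^ 'd) \<Rightarrow> bool" where
  "block_lipschitz_gradient n blk p L g \<longleftrightarrow>
     (\<forall>x. \<forall>i\<in>{1..n}. \<forall>t\<in>block_space blk i.
        conj_norm (block_space blk i) (p i) (block_part blk i (g (x + t)) - block_part blk i (g x))
          \<le> L i * p i t)"

definition balanced_partition :: "nat \<Rightarrow> nat \<Rightarrow> nat \<Rightarrow> (nat \<Rightarrow> nat set) \<Rightarrow> bool" where
  "balanced_partition n C s P \<longleftrightarrow>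
     disjoint_family_on P {1..C} \<and> (\<Union>c\<in>{1..C}. P c) = {1..n} \<and>
     (\<forall>c\<in>{1..C}. card (P c) = s) \<and> real s = real n / real C"

(* The law of the union of independent random sets, the c-th one being uniform on the
   \<tau>-element subsets of P c. *)
definition distributed_sampling :: "nat \<Rightarrow> nat \<Rightarrow> (nat \<Rightarrow> nat set) \<Rightarrow> nat set pmf" where
  "distributed_sampling C \<tau> P =
     map_pmf (\<lambda>Z. \<Union>c\<in>{1..C}. Z c)
       (Pi_pmf {1..C} {} (\<lambda>c. pmf_of_set {S. S \<subseteq> P c \<and> card S = \<tau>}))"

(* g is the gradient of f; Z is the law of the sampling. *)
definition admits_ESO ::
    "nat \<Rightarrow> ('d::finite \<Rightarrow> nat) \<Rightarrow> (nat \<Rightarrow> real ^ 'd \<Rightarrow> real) \<Rightarrow> (real ^ 'd \<Rightarrow> real)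
       \<Rightarrow> (real ^ 'd \<Rightarrow> real ^ 'd) \<Rightarrow> nat set pmf \<Rightarrow> real \<Rightarrow> (nat \<Rightarrow> real) \<Rightarrow> bool" where
  "admits_ESO n blk p f g Z \<beta> w \<longleftrightarrow>
     0 < \<beta> \<and> (\<forall>i\<in>{1..n}. 0 < w i) \<and>
     (\<forall>x h. measure_pmf.expectation Z (\<lambda>S. f (x + restrict_blocks blk S h))
        \<le> f x + measure_pmf.expectation Z (\<lambda>S. real (card S)) / real n
              * (g x \<bullet> h + \<beta> / 2 * (weighted_norm n blk p w h)\<^sup>2))"

end

theory Submission
  imports Defs
begin

text \<open>
  Every \<open>J\<close> can be enlarged to a set \<open>K\<close> meeting each part in exactly \<open>\<xi>\<close> points, since \<open>F J\<close>
  still depends only on the blocks in \<open>K\<close>. With \<open>k = card (Z \<inter> K)\<close>, the point \<open>x + h\<^bsub>[Z \<inter> K]\<^esub>\<close>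
  is the average of the \<open>k\<close> points \<open>x + k h\<^sup>(\<^sup>i\<^sup>)\<close>, \<open>i \<in> Z \<inter> K\<close>, so convexity bounds \<open>F J\<close> there by
  the average of its values at these points. The joint law of the event \<open>i \<in> Z\<close> and of \<open>k\<close> does not
  depend on which such \<open>K\<close> containing \<open>i\<close> is taken, so after averaging over \<open>Z\<close> the sum over \<open>J\<close>
  can be moved inside. It turns \<open>F J\<close> into \<open>f\<close>, and the block Lipschitz condition bounds
  \<open>f (x + k h\<^sup>(\<^sup>i\<^sup>))\<close>. What remains are the inclusion probabilities of points and of pairs of points,
  which follow from symmetry under transpositions inside a part.
\<close>

section \<open>Samples of an equipartition\<close>

locale equipartition =
  fixes I :: "'c set" and P :: "'c \<Rightarrow> 'a set" and s \<tau> :: nat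
  assumes finite_I: "finite I"
    and disjoint: "disjoint_family_on P I"
    and finite_P: "c \<in> I \<Longrightarrow> finite (P c)"
    and card_P: "c \<in> I \<Longrightarrow> card (P c) = s"
    and tau_ge_1: "1 \<le> \<tau>"
    and tau_le: "\<tau> \<le> s"
begin

text \<open>These are the possible values of the distributed sampling. By
  \<open>Pi_pmf_union_eq\<close> they are equally likely, so every expectation becomes a finite sum
  over \<open>samples\<close>, and probabilities become cardinalities.\<close>

definition samples :: "'a set set" where
  "samples = {Z. Z \<subseteq> (\<Union>c\<in>I. P c) \<and> (\<forall>c\<in>I. card (Z \<inter> P c) = \<tau>)}"

lemma finite_ground: "finite (\<Union>c\<in>I. P c)"
  using finite_I finite_P by blast

lemma finite_samples: "finite samples"
  unfolding samples_def using finite_ground by simp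

lemma finite_sample: "Z \<in> samples \<Longrightarrow> finite Z"
  unfolding samples_def using finite_ground finite_subset by blast

lemma part_unique: "c \<in> I \<Longrightarrow> d \<in> I \<Longrightarrow> a \<in> P c \<Longrightarrow> a \<in> P d \<Longrightarrow> c = d"
  using disjoint unfolding disjoint_family_on_def by blast

lemma card_split:
  assumes "B \<subseteq> (\<Union>c\<in>I. P c)"
  shows "card B = (\<Sum>c\<in>I. card (B \<inter> P c))"
proof -
  have "B = (\<Union>c\<in>I. B \<inter> P c)"
    using assms by blast
  moreover have "card (\<Union>c\<in>I. B \<inter> P c) = (\<Sum>c\<in>I. card (B \<inter> P c))"
    using finite_I finite_P part_unique by (intro card_UN_disjoint) blast+
  ultimately show ?thesis by simp
qed

lemma sum_split:
  fixes u :: "'a \<Rightarrow> real"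
  assumes "B \<subseteq> (\<Union>c\<in>I. P c)"
  shows "sum u B = (\<Sum>c\<in>I. sum u (B \<inter> P c))"
proof -
  have "B = (\<Union>c\<in>I. B \<inter> P c)"
    using assms by blast
  moreover have "sum u (\<Union>c\<in>I. B \<inter> P c) = (\<Sum>c\<in>I. sum u (B \<inter> P c))"
    using finite_I finite_P part_unique by (intro sum.UNION_disjoint) blast+
  ultimately show ?thesis by simp
qed

lemma card_sample: "Z \<in> samples \<Longrightarrow> card Z = card I * \<tau>"
  using card_split[of Z] by (simp add: samples_def)

section \<open>Transpositions inside a part acting on the samples\<close>

lemma transpose_image_part:
  assumes "c \<in> I" "a \<in> P c" "b \<in> P c" "d \<in> I"
  shows "Transposition.transpose a b ` P d = P d"
  using assms part_unique[of c d] by (intro transpose_image_eq) auto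

lemma transpose_sample:
  assumes "c \<in> I" "a \<in> P c" "b \<in> P c" "Z \<in> samples"
  shows "Transposition.transpose a b ` Z \<in> samples"
proof -
  have "Transposition.transpose a b ` Z \<inter> P d = Transposition.transpose a b ` (Z \<inter> P d)" if "d \<in> I" for d
    using transpose_image_part[OF assms(1-3) that] by (simp add: image_Int[OF inj_transpose])
  moreover have "Transposition.transpose a b ` Z \<subseteq> (\<Union>c\<in>I. Transposition.transpose a b ` P c)"
    using assms(4) unfolding samples_def by blast
  ultimately show ?thesis
    using assms transpose_image_part[OF assms(1-3)]
    unfolding samples_def by (auto simp: card_image)
qed

text \<open>Taking images under the transposition is an involution of \<open>samples\<close>, so it
  merely permutes the summands. All symmetry arguments below rest on this.\<close>

lemma sum_samples_transpose:
  fixes u :: "'a set \<Rightarrow> real"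
  assumes "c \<in> I" "a \<in> P c" "b \<in> P c"
  shows "(\<Sum>Z\<in>samples. u (Transposition.transpose a b ` Z)) = (\<Sum>Z\<in>samples. u Z)"
  by (rule sum.reindex_bij_witness[of _ "(`) (Transposition.transpose a b)" "(`) (Transposition.transpose a b)"])
    (use transpose_sample[OF assms] in \<open>auto simp: image_image\<close>)

lemma mem_transpose_image: "j \<in> Transposition.transpose a b ` Z \<longleftrightarrow> Transposition.transpose a b j \<in> Z"
  by (metis image_iff transpose_involutory)

lemma mem_transpose_image_other:
  "j \<noteq> a \<Longrightarrow> j \<noteq> b \<Longrightarrow> j \<in> Transposition.transpose a b ` Z \<longleftrightarrow> j \<in> Z"
  by (simp add: mem_transpose_image)

section \<open>Sets with equally many points in every part\<close>

definition balanced :: "nat \<Rightarrow> 'a set \<Rightarrow> bool" where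
  "balanced \<xi> J \<longleftrightarrow> J \<subseteq> (\<Union>c\<in>I. P c) \<and> (\<forall>c\<in>I. card (P c \<inter> J) = \<xi>)"

lemma balanced_finite: "balanced \<xi> J \<Longrightarrow> finite J"
  unfolding balanced_def using finite_ground finite_subset by blast

text \<open>Any two balanced sets containing \<open>i\<close> are connected by transpositions inside the parts
  that fix \<open>i\<close>, and these preserve the samples.\<close>

lemma sum_balanced_eq:
  fixes u :: "nat \<Rightarrow> real"
  assumes "balanced \<xi> J" "balanced \<xi> K" "i \<in> J" "i \<in> K"
  shows "(\<Sum>Z\<in>{Z\<in>samples. i \<in> Z}. u (card (Z \<inter> J))) = (\<Sum>Z\<in>{Z\<in>samples. i \<in> Z}. u (card (Z \<inter> K)))"
  using assms
proof (induction "card (J - K)" arbitrary: J)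
  case 0
  have fin: "finite J" "finite K"
    using 0 balanced_finite by auto
  then have "J \<subseteq> K"
    using 0 by simp
  moreover have "card J = card K"
    using 0 by (simp add: balanced_def card_split Int_commute)
  ultimately have "J = K"
    using fin card_subset_eq by blast
  then show ?case by simp
next
  case (Suc m)
  have fin: "finite J" "finite K"
    using Suc balanced_finite by auto
  obtain a where a: "a \<in> J" "a \<notin> K"
    using Suc(2) by (metis Diff_iff card.empty equals0I nat.distinct(1))
  then obtain c where c: "c \<in> I" "a \<in> P c"
    using Suc.prems(1) unfolding balanced_def by blast
  have cards: "card (P c \<inter> J) = card (P c \<inter> K)"
    using Suc.prems(1,2) c unfolding balanced_def by simp
  obtain b where b: "b \<in> P c" "b \<in> K" "b \<notin> J"
  proof (rule ccontr)
    assume "\<not> thesis"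
    then have "P c \<inter> K \<subset> P c \<inter> J"
      using a c that by blast
    then have "card (P c \<inter> K) < card (P c \<inter> J)"
      using fin by (intro psubset_card_mono) auto
    then show False
      using cards by simp
  qed
  let ?t = "Transposition.transpose a b"
  let ?J = "?t ` J"
  have ti: "?t i = i"
    using a b Suc.prems(3,4) by (intro transpose_apply_other) auto
  have J': "?J = insert b (J - {a})"
    using a b by (intro set_eqI) (auto simp: mem_transpose_image Transposition.transpose_def split: if_splits)
  \<comment> \<open>The swap trades \<open>a\<close>, outside \<open>K\<close>, for \<open>b\<close>
    of the same part, inside \<open>K\<close>. The number of points outside \<open>K\<close> drops
    by one and the counts in the parts stay the same.\<close>
  have diff: "?J - K = J - K - {a}"
    using a b J' by auto
  have "balanced \<xi> ?J"
  proof -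
    have "P d \<inter> ?J = ?t ` (P d \<inter> J)" if "d \<in> I" for d
      using transpose_image_part[OF c b(1) that] by (simp add: image_Int[OF inj_transpose])
    moreover have "?J \<subseteq> (\<Union>c\<in>I. P c)"
      unfolding J' using b(1) c(1) Suc.prems(1) by (auto simp: balanced_def)
    ultimately show ?thesis
      using Suc.prems(1) unfolding balanced_def by (simp add: card_image)
  qed
  moreover have "m = card (?J - K)"
    using Suc(2) diff a fin by simp
  moreover have "i \<in> ?J"
    using ti Suc.prems(3) by (metis imageI)
  ultimately have IH: "(\<Sum>Z\<in>{Z\<in>samples. i \<in> Z}. u (card (Z \<inter> ?J))) =
      (\<Sum>Z\<in>{Z\<in>samples. i \<in> Z}. u (card (Z \<inter> K)))"
    by (intro Suc.hyps(1) Suc.prems)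
  have card_image_Int: "card (?t ` Z \<inter> ?J) = card (Z \<inter> J)" for Z
    unfolding image_Int[OF inj_transpose, symmetric] by (simp add: card_image)
  have "(\<Sum>Z\<in>{Z\<in>samples. i \<in> Z}. u (card (Z \<inter> J))) =
      (\<Sum>Z\<in>samples. if i \<in> Z then u (card (Z \<inter> J)) else 0)"
    using finite_samples by (simp add: sum.inter_filter)
  \<comment> \<open>Since \<open>?t\<close> fixes \<open>i\<close> and carries \<open>J\<close> to
    \<open>?J\<close>, the summand at \<open>Z\<close> for \<open>J\<close> is the summand at the
    image of \<open>Z\<close> for \<open>?J\<close>.\<close>
  also have "\<dots> = (\<Sum>Z\<in>samples. if i \<in> ?t ` Z then u (card (?t ` Z \<inter> ?J)) else 0)"
    by (intro sum.cong) (simp_all add: mem_transpose_image ti card_image_Int)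
  also have "\<dots> = (\<Sum>Z\<in>samples. if i \<in> Z then u (card (Z \<inter> ?J)) else 0)"
    by (rule sum_samples_transpose[OF c b(1)])
  also have "\<dots> = (\<Sum>Z\<in>{Z\<in>samples. i \<in> Z}. u (card (Z \<inter> ?J)))"
    using finite_samples by (simp add: sum.inter_filter)
  finally show ?case
    using IH by simp
qed

text \<open>Double counting. Transpositions inside \<open>K\<close> show that the sum over the
  samples containing a given point of \<open>K\<close> is the same for all these points. Added over
  \<open>K\<close>, these sums count each \<open>Z\<close> exactly
  \<open>card (Z \<inter> K)\<close> times. That number has to be \<open>m\<close> only where
  \<open>u Z\<close> is nonzero, so that \<open>u\<close> can be an indicator that selects some of
  the samples.\<close>

lemma card_mult_sum_containing:
  fixes u :: "'a set \<Rightarrow> real"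
  assumes c: "c \<in> I" and K: "K \<subseteq> P c" "j \<in> K"
    and u: "\<And>Z a b. Z \<in> samples \<Longrightarrow> a \<in> K \<Longrightarrow> b \<in> K \<Longrightarrow> u (Transposition.transpose a b ` Z) = u Z"
    and m: "\<And>Z. Z \<in> samples \<Longrightarrow> u Z \<noteq> 0 \<Longrightarrow> card (Z \<inter> K) = m"
  shows "real (card K) * (\<Sum>Z\<in>{Z\<in>samples. j \<in> Z}. u Z) = real m * (\<Sum>Z\<in>samples. u Z)"
proof -
  have fK: "finite K"
    using K(1) finite_P[OF c] finite_subset by blast
  have eq: "(\<Sum>Z\<in>{Z\<in>samples. b \<in> Z}. u Z) = (\<Sum>Z\<in>{Z\<in>samples. j \<in> Z}. u Z)" if "b \<in> K" for b
  proof -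
    have "(\<Sum>Z\<in>samples. if b \<in> Z then u Z else 0) =
        (\<Sum>Z\<in>samples. if b \<in> Transposition.transpose j b ` Z then u (Transposition.transpose j b ` Z) else 0)"
      using K that c by (subst sum_samples_transpose) auto
    also have "\<dots> = (\<Sum>Z\<in>samples. if j \<in> Z then u Z else 0)"
      using K that by (intro sum.cong) (auto simp: mem_transpose_image u)
    finally show ?thesis
      using finite_samples by (simp add: sum.inter_filter)
  qed
  have "real (card K) * (\<Sum>Z\<in>{Z\<in>samples. j \<in> Z}. u Z) = (\<Sum>b\<in>K. \<Sum>Z\<in>{Z\<in>samples. b \<in> Z}. u Z)"
    using eq by simp
  also have "\<dots> = (\<Sum>Z\<in>samples. \<Sum>b\<in>K. if b \<in> Z then u Z else 0)"
    using finite_samples by (simp add: sum.inter_filter) (rule sum.swap)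
  also have "\<dots> = (\<Sum>Z\<in>samples. real (card (Z \<inter> K)) * u Z)"
    using fK by (simp add: sum.If_cases Int_commute)
  also have "\<dots> = (\<Sum>Z\<in>samples. real m * u Z)"
  proof (rule sum.cong)
    fix Z assume "Z \<in> samples"
    then show "real (card (Z \<inter> K)) * u Z = real m * u Z"
      using m[of Z] by (cases "u Z = 0") auto
  qed simp
  finally show ?thesis
    by (simp add: sum_distrib_left)
qed

section \<open>Inclusion counts of points and of pairs of points\<close>

lemma card_containing:
  assumes "c \<in> I" "i \<in> P c"
  shows "real s * real (card {Z\<in>samples. i \<in> Z}) = real \<tau> * real (card samples)"
proof -
  have "card (Z \<inter> P c) = \<tau>" if "Z \<in> samples" for Z
    using that assms(1) by (simp add: samples_def)
  then show ?thesis
    using card_mult_sum_containing[OF assms(1) order.refl assms(2), of "\<lambda>_. 1" \<tau>] card_P[OF assms(1)]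
    by simp
qed

text \<open>Double counting over the part of \<open>j\<close>, with \<open>u\<close> the indicator
  of \<open>i \<in> Z\<close>: transpositions inside \<open>P d\<close> do not move
  \<open>i\<close>. This is the independence of different parts in the form of a count.\<close>

lemma card_containing_other_part:
  assumes "c \<in> I" "i \<in> P c" "d \<in> I" "j \<in> P d" "c \<noteq> d"
  shows "real s * real (card {Z\<in>samples. i \<in> Z \<and> j \<in> Z}) = real \<tau> * real (card {Z\<in>samples. i \<in> Z})"
proof -
  have "i \<notin> P d"
    using assms part_unique by blast
  then have "of_bool (i \<in> Transposition.transpose a b ` Z) = (of_bool (i \<in> Z) :: real)" if "a \<in> P d" "b \<in> P d" for a b Z
    using that by (subst mem_transpose_image_other) auto
  then have "real (card (P d)) * (\<Sum>Z\<in>{Z\<in>samples. j \<in> Z}. of_bool (i \<in> Z)) =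
      real \<tau> * (\<Sum>Z\<in>samples. of_bool (i \<in> Z))"
    using assms by (intro card_mult_sum_containing[of d]) (auto simp: samples_def)
  then show ?thesis
    using finite_samples card_P[OF assms(3)] by (simp add: Int_def conj_ac)
qed

text \<open>The point \<open>i\<close> is removed from its part so that the transpositions fix it. A
  sample that contains \<open>i\<close> meets the remaining \<open>s - 1\<close> points in
  \<open>\<tau> - 1\<close> points.\<close>

lemma card_containing_same_part:
  assumes "c \<in> I" "i \<in> P c" "j \<in> P c" "i \<noteq> j"
  shows "(real s - 1) * real (card {Z\<in>samples. i \<in> Z \<and> j \<in> Z}) =
    (real \<tau> - 1) * real (card {Z\<in>samples. i \<in> Z})"
proof -
  have "of_bool (i \<in> Transposition.transpose a b ` Z) = (of_bool (i \<in> Z) :: real)" if "a \<in> P c - {i}" "b \<in> P c - {i}" for a b Z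
    using that by (subst mem_transpose_image_other) auto
  moreover have "card (Z \<inter> (P c - {i})) = \<tau> - 1" if "Z \<in> samples" "i \<in> Z" for Z
  proof -
    have "Z \<inter> (P c - {i}) = Z \<inter> P c - {i}" by blast
    then show ?thesis
      using that assms finite_sample[of Z] by (auto simp: samples_def)
  qed
  ultimately have "real (card (P c - {i})) * (\<Sum>Z\<in>{Z\<in>samples. j \<in> Z}. of_bool (i \<in> Z)) =
      real (\<tau> - 1) * (\<Sum>Z\<in>samples. of_bool (i \<in> Z))"
    using assms by (intro card_mult_sum_containing[of c]) auto
  moreover have "card (P c - {i}) = s - 1"
    using assms card_P finite_P by simp
  ultimately show ?thesis
    using finite_samples tau_ge_1 tau_le by (simp add: Int_def conj_ac of_nat_diff)
qed

text \<open>The factor is the conditional expectation of \<open>card (Z \<inter> B)\<close> given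
  \<open>i \<in> Z\<close>, and it is where \<beta> comes from. The point \<open>i\<close>
  contributes 1, each of the other \<open>\<xi> - 1\<close> points of \<open>B\<close> in its part
  contributes \<open>(\<tau> - 1) / (s - 1)\<close>, and each of the \<xi> points in every other
  part contributes \<open>\<tau> / s\<close>.\<close>

lemma sum_card_Int_balanced:
  assumes B: "balanced \<xi> B" and i: "i \<in> B"
  shows "(\<Sum>Z\<in>{Z\<in>samples. i \<in> Z}. real (card (Z \<inter> B))) =
    (1 + (real \<xi> - 1) * (real \<tau> - 1) / max 1 (real s - 1)
      + (real (card I) - 1) * (real \<xi> * real \<tau> / real s)) * real (card {Z\<in>samples. i \<in> Z})"
proof -
  let ?N = "real (card {Z\<in>samples. i \<in> Z})"
  let ?M = "\<lambda>j. real (card {Z\<in>samples. i \<in> Z \<and> j \<in> Z})"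
  obtain c where c: "c \<in> I" "i \<in> P c"
    using B i unfolding balanced_def by blast
  have fB: "finite B"
    using B balanced_finite by blast
  have s: "real s > 0"
    using tau_ge_1 tau_le by simp
  have cardB: "card (B \<inter> P d) = \<xi>" if "d \<in> I" for d
    using B that by (simp add: balanced_def Int_commute)
  have xi_ge: "1 \<le> \<xi>"
    using cardB[OF c(1)] c i fB by (metis Int_iff One_nat_def Suc_leI card_gt_0_iff empty_iff finite_Int)
  have other: "sum ?M (B \<inter> P d) = real \<xi> * real \<tau> / real s * ?N" if "d \<in> I - {c}" for d
  proof -
    have "?M j = real \<tau> / real s * ?N" if "j \<in> B \<inter> P d" for j
      using card_containing_other_part[OF c, of d j] that \<open>d \<in> I - {c}\<close> s by (auto simp: field_simps)
    then show ?thesis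
      using that cardB by simp
  qed
  have same: "sum ?M (B \<inter> P c) = ?N + (real \<xi> - 1) * (real \<tau> - 1) / max 1 (real s - 1) * ?N"
  proof -
    have "?M j = (real \<tau> - 1) / max 1 (real s - 1) * ?N" if "j \<in> B \<inter> P c - {i}" for j
    proof -
      \<comment> \<open>Two distinct points in one part force \<open>s \<ge> 2\<close>, so the
        maximum in the denominator is \<open>s - 1\<close>. For \<open>s = 1\<close> there is no
        such \<open>j\<close>.\<close>
      have "card {i, j} \<le> card (P c)"
        using that c finite_P by (intro card_mono) auto
      then have "real s - 1 \<ge> 1"
        using card_P[OF c(1)] that by auto
      then show ?thesis
        using card_containing_same_part[OF c, of j] that by (auto simp: field_simps)
    qed
    then have "sum ?M (B \<inter> P c - {i}) = real (card (B \<inter> P c - {i})) * ((real \<tau> - 1) / max 1 (real s - 1) * ?N)"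
      by simp
    moreover have "card (B \<inter> P c - {i}) = \<xi> - 1"
      using cardB[OF c(1)] c i fB by simp
    moreover have "sum ?M (B \<inter> P c) = ?M i + sum ?M (B \<inter> P c - {i})"
      using fB c i by (intro sum.remove) auto
    ultimately show ?thesis
      using xi_ge by (simp add: of_nat_diff)
  qed
  have "(\<Sum>Z\<in>{Z\<in>samples. i \<in> Z}. real (card (Z \<inter> B))) =
      (\<Sum>Z\<in>{Z\<in>samples. i \<in> Z}. \<Sum>j\<in>B. of_bool (j \<in> Z))"
    using fB by (simp add: Int_commute Int_def)
  also have "\<dots> = (\<Sum>j\<in>B. \<Sum>Z\<in>{Z\<in>samples. i \<in> Z}. of_bool (j \<in> Z))"
    by (rule sum.swap)
  also have "\<dots> = sum ?M B"
    using finite_samples by (simp add: Int_def conj_ac)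
  also have "\<dots> = (\<Sum>d\<in>I. sum ?M (B \<inter> P d))"
    using B by (intro sum_split) (simp add: balanced_def)
  also have "\<dots> = sum ?M (B \<inter> P c) + (\<Sum>d\<in>I - {c}. sum ?M (B \<inter> P d))"
    using finite_I c by (intro sum.remove) auto
  also have "(\<Sum>d\<in>I - {c}. sum ?M (B \<inter> P d)) = (real (card I) - 1) * (real \<xi> * real \<tau> / real s * ?N)"
  proof -
    have "card I \<ge> 1"
      using finite_I c by (metis One_nat_def Suc_leI card_gt_0_iff empty_iff)
    then show ?thesis
      using finite_I c other by (simp add: of_nat_diff)
  qed
  finally show ?thesis
    using same by (simp add: algebra_simps)
qed

text \<open>Each part has room for \<xi> points because \<open>\<xi> \<le> s\<close>, and
  disjointness keeps the choices made in different parts from interfering.\<close>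

lemma balanced_extension:
  assumes "J \<subseteq> (\<Union>c\<in>I. P c)" "\<And>c. c \<in> I \<Longrightarrow> card (P c \<inter> J) \<le> \<xi>" "\<xi> \<le> s"
  shows "\<exists>K. balanced \<xi> K \<and> J \<subseteq> K"
proof -
  have "\<exists>K. P c \<inter> J \<subseteq> K \<and> K \<subseteq> P c \<and> card K = \<xi>" if "c \<in> I" for c
    using exists_subset_between[of "P c \<inter> J" \<xi> "P c"] assms(2)[OF that] assms(3) card_P[OF that] finite_P[OF that]
    by (metis Int_lower1)
  then obtain k where k: "\<And>c. c \<in> I \<Longrightarrow> P c \<inter> J \<subseteq> k c \<and> k c \<subseteq> P c \<and> card (k c) = \<xi>"
    by metis
  have "P c \<inter> (\<Union>d\<in>I. k d) = k c" if "c \<in> I" for c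
    using k part_unique that by blast
  then have "balanced \<xi> (\<Union>d\<in>I. k d)"
    unfolding balanced_def using k by auto
  moreover have "J \<subseteq> (\<Union>d\<in>I. k d)"
  proof
    fix j assume "j \<in> J"
    then obtain c where "c \<in> I" "j \<in> P c"
      using assms(1) by blast
    then show "j \<in> (\<Union>d\<in>I. k d)"
      using k[of c] \<open>j \<in> J\<close> by blast
  qed
  ultimately show ?thesis by blast
qed

section \<open>The sampling law is uniform on the samples\<close>

lemma samples_nonempty: "samples \<noteq> {}"
  \<comment> \<open>A sample is the same thing as a set that is balanced with parameter
    \<tau>.\<close>
  using balanced_extension[of "{}" \<tau>] tau_le
  by (auto simp: balanced_def samples_def Int_commute)

text \<open>A product of uniform laws is uniform on the product set. The union map is injective
  there, since \<open>Z c\<close> is recovered by intersecting the union with \<open>P c\<close> and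
  equals the default \<open>{}\<close> outside \<open>I\<close>; hence its image law is uniform
  too.\<close>

lemma Pi_pmf_union_eq:
  "map_pmf (\<lambda>Z. \<Union>c\<in>I. Z c) (Pi_pmf I {} (\<lambda>c. pmf_of_set {S. S \<subseteq> P c \<and> card S = \<tau>})) =
    pmf_of_set samples"
proof -
  let ?B = "\<lambda>c. {S. S \<subseteq> P c \<and> card S = \<tau>}"
  let ?U = "\<lambda>Z. \<Union>c\<in>I. Z c"
  have nonempty: "?B c \<noteq> {}" if "c \<in> I" for c
  proof -
    obtain S where "S \<subseteq> P c" "card S = \<tau>"
      using obtain_subset_with_card_n[of \<tau> "P c"] tau_le card_P[OF \<open>c \<in> I\<close>] by metis
    then show ?thesis by blast
  qed
  have fin: "finite (?B c)" if "c \<in> I" for c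
    using finite_P[OF that] by simp
  have part: "?U Z \<inter> P c = Z c" if "Z \<in> PiE_dflt I {} ?B" "c \<in> I" for Z c
  proof -
    have "Z d \<subseteq> P d" if "d \<in> I" for d
      using \<open>Z \<in> PiE_dflt I {} ?B\<close> that by (simp add: PiE_dflt_def)
    then show ?thesis
      using \<open>c \<in> I\<close> part_unique by blast
  qed
  have "Pi_pmf I {} (\<lambda>c. pmf_of_set (?B c)) = pmf_of_set (PiE_dflt I {} ?B)"
    using finite_I nonempty fin by (intro Pi_pmf_of_set) auto
  moreover have "inj_on ?U (PiE_dflt I {} ?B)"
  proof (rule inj_onI)
    fix Y Z assume YZ: "Y \<in> PiE_dflt I {} ?B" "Z \<in> PiE_dflt I {} ?B" "?U Y = ?U Z"
    show "Y = Z"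
    proof
      fix c show "Y c = Z c"
        using part[OF YZ(1), of c] part[OF YZ(2), of c] YZ by (cases "c \<in> I") (auto simp: PiE_dflt_def)
    qed
  qed
  moreover have "?U ` PiE_dflt I {} ?B = samples"
  proof (intro equalityI subsetI)
    fix S assume "S \<in> ?U ` PiE_dflt I {} ?B"
    then obtain Z where Z: "Z \<in> PiE_dflt I {} ?B" "S = ?U Z" by blast
    then show "S \<in> samples"
      using part[OF Z(1)] unfolding samples_def by (auto simp: PiE_dflt_def)
  next
    fix S assume S: "S \<in> samples"
    let ?Z = "\<lambda>c. if c \<in> I then S \<inter> P c else {}"
    have "?Z \<in> PiE_dflt I {} ?B" "S = ?U ?Z"
      using S by (auto simp: samples_def PiE_dflt_def)
    then show "S \<in> ?U ` PiE_dflt I {} ?B" by blast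
  qed
  moreover have "finite (PiE_dflt I {} ?B)" "PiE_dflt I {} ?B \<noteq> {}"
    using finite_I nonempty fin by (intro finite_PiE_dflt; simp) (use nonempty in auto)
  ultimately show ?thesis
    by (simp add: map_pmf_of_set_inj)
qed

end

section \<open>Descent along a block\<close>

lemma subspace_block_space: "subspace (block_space blk i)"
  by (auto simp: block_space_def subspace_def)

lemma block_part_in_block_space: "block_part blk i x \<in> block_space blk i"
  by (simp add: block_part_def block_space_def)

lemma inner_block_part_left:
  assumes "t \<in> block_space blk i"
  shows "block_part blk i y \<bullet> t = y \<bullet> t"
  using assms unfolding inner_vec_def block_part_def block_space_def
  by (intro sum.cong) auto

section \<open>Comparison of a norm on a subspace with the Euclidean norm\<close>

lemma is_norm_on_0:
  assumes "subspace V" "is_norm_on V p"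
  shows "p 0 = 0"
  using assms subspace_0[of V] unfolding is_norm_on_def by blast

lemma is_norm_on_sum_le:
  assumes V: "subspace V" and p: "is_norm_on V p" and A: "finite A" "\<And>k. k \<in> A \<Longrightarrow> v k \<in> V"
  shows "p (\<Sum>k\<in>A. v k) \<le> (\<Sum>k\<in>A. p (v k))"
  using A
proof (induction A rule: finite_induct)
  case empty
  then show ?case
    using is_norm_on_0[OF V p] by simp
next
  case (insert a A)
  then have "v a \<in> V" "(\<Sum>k\<in>A. v k) \<in> V"
    using subspace_sum[OF V, of A v] by auto
  then have "p (v a + (\<Sum>k\<in>A. v k)) \<le> p (v a) + p (\<Sum>k\<in>A. v k)"
    using p unfolding is_norm_on_def by blast
  then show ?case
    using insert by simp
qed

text \<open>Expand \<open>t\<close> in an orthonormal basis of \<open>V\<close>. Every coefficient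
  is at most \<open>norm t\<close> in absolute value, so the sum of \<open>p\<close> over the basis
  serves as the constant.\<close>

lemma is_norm_on_le_norm:
  fixes V :: "'a::euclidean_space set"
  assumes V: "subspace V" and p: "is_norm_on V p"
  shows "\<exists>K\<ge>0. \<forall>t\<in>V. p t \<le> K * norm t"
proof -
  obtain B where B: "B \<subseteq> V" "pairwise orthogonal B" "\<And>b. b \<in> B \<Longrightarrow> norm b = 1"
      "independent B" "span B = V"
    using orthonormal_basis_subspace[OF V] by metis
  have fB: "finite B"
    using B(4) finiteI_independent by blast
  have nonneg: "p b \<ge> 0" if "b \<in> V" for b
    using p that by (simp add: is_norm_on_def)
  have "p t \<le> (\<Sum>b\<in>B. p b) * norm t" if t: "t \<in> V" for t
  proof -
    have ortho: "b \<bullet> c = (if b = c then 1 else 0)" if "b \<in> B" "c \<in> B" for b c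
      using B(2) B(3)[of b] that by (auto simp: pairwise_def orthogonal_def norm_eq_1)
    have expand: "t = (\<Sum>b\<in>B. (t \<bullet> b) *\<^sub>R b)"
    proof -
      obtain u where u: "t = (\<Sum>b\<in>B. u b *\<^sub>R b)"
        using t B(5) span_finite[OF fB] by auto
      have "t \<bullet> c = u c" if "c \<in> B" for c
      proof -
        have "t \<bullet> c = (\<Sum>b\<in>B. if b = c then u b else 0)"
          unfolding u inner_sum_left using that by (intro sum.cong) (auto simp: ortho)
        then show ?thesis
          using fB that by simp
      qed
      then show ?thesis
        using u by simp
    qed
    have "p t \<le> (\<Sum>b\<in>B. p ((t \<bullet> b) *\<^sub>R b))"
      using is_norm_on_sum_le[OF V p fB, of "\<lambda>b. (t \<bullet> b) *\<^sub>R b"] B(1) V expand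
      by (auto simp: subspace_scale subsetD)
    also have "\<dots> = (\<Sum>b\<in>B. \<bar>t \<bullet> b\<bar> * p b)"
      using p B(1) by (intro sum.cong) (auto simp: is_norm_on_def)
    also have "\<dots> \<le> (\<Sum>b\<in>B. norm t * p b)"
      using Cauchy_Schwarz_ineq2[of t] B(1,3) nonneg
      by (intro sum_mono mult_right_mono) (auto, metis mult.right_neutral)
    finally show ?thesis
      by (simp add: sum_distrib_left mult.commute)
  qed
  moreover have "(\<Sum>b\<in>B. p b) \<ge> 0"
    using B(1) nonneg by (intro sum_nonneg) auto
  ultimately show ?thesis by blast
qed

lemma continuous_on_is_norm_on:
  fixes V :: "'a::euclidean_space set"
  assumes V: "subspace V" and p: "is_norm_on V p"
  shows "continuous_on V p"
proof -
  obtain K where K: "K \<ge> 0" "\<And>t. t \<in> V \<Longrightarrow> p t \<le> K * norm t"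
    using is_norm_on_le_norm[OF V p] by blast
  have half: "p s - p t \<le> K * norm (s - t)" if "s \<in> V" "t \<in> V" for s t
  proof -
    have "p ((s - t) + t) \<le> p (s - t) + p t"
      using p that subspace_diff[OF V] unfolding is_norm_on_def by blast
    then show ?thesis
      using K(2)[of "s - t"] that subspace_diff[OF V] by simp
  qed
  have "K-lipschitz_on V p"
  proof (rule lipschitz_onI)
    fix s t assume "s \<in> V" "t \<in> V"
    then show "dist (p s) (p t) \<le> K * dist s t"
      using half[of s t] half[of t s] by (auto simp: dist_norm norm_minus_commute abs_le_iff)
  qed (rule K(1))
  then show ?thesis
    by (rule lipschitz_on_continuous_on)
qed

text \<open>By continuity \<open>p\<close> attains a minimum on the compact unit sphere of
  \<open>V\<close>. The minimum is positive by definiteness and serves as the constant by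
  homogeneity. If that sphere is empty, \<open>V\<close> is trivial and any constant works.\<close>

lemma norm_le_is_norm_on:
  fixes V :: "'a::euclidean_space set"
  assumes V: "subspace V" and p: "is_norm_on V p"
  shows "\<exists>m>0. \<forall>t\<in>V. m * norm t \<le> p t"
proof (cases "V \<inter> sphere 0 1 = {}")
  case True
  have "norm t = 0" if "t \<in> V" for t
  proof (rule ccontr)
    assume "norm t \<noteq> 0"
    then have "(1 / norm t) *\<^sub>R t \<in> V \<inter> sphere 0 1"
      using that V by (simp add: subspace_scale)
    then show False
      using True by blast
  qed
  then show ?thesis
    using p by (intro exI[of _ 1]) (simp add: is_norm_on_def)
next
  case False
  have "compact (V \<inter> sphere 0 1)"
    using closed_subspace[OF V] by (simp add: closed_Int_compact)
  then obtain t0 where t0: "t0 \<in> V \<inter> sphere 0 1" "\<And>t. t \<in> V \<inter> sphere 0 1 \<Longrightarrow> p t0 \<le> p t"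
    using continuous_attains_inf[OF _ False continuous_on_subset[OF continuous_on_is_norm_on[OF V p]]]
    by auto
  have "p t0 \<noteq> 0" "p t0 \<ge> 0"
    using p t0(1) by (auto simp: is_norm_on_def)
  then have "p t0 > 0" by simp
  moreover have "p t0 * norm t \<le> p t" if "t \<in> V" for t
  proof (cases "t = 0")
    case True
    then show ?thesis
      using p that by (simp add: is_norm_on_def)
  next
    case False
    have "p t0 \<le> p ((1 / norm t) *\<^sub>R t)"
      using t0(2) False that V by (simp add: subspace_scale)
    also have "\<dots> = p t / norm t"
      using p that by (simp add: is_norm_on_def)
    finally show ?thesis
      using False by (simp add: field_simps)
  qed
  ultimately show ?thesis by blast
qed

text \<open>Rescale \<open>t\<close> to the unit ball of \<open>p\<close>. The comparison of norms
  enters because the supremum in \<open>conj_norm\<close> is known to dominate its members only once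
  they are bounded above.\<close>

lemma inner_le_conj_norm:
  fixes V :: "'a::euclidean_space set"
  assumes V: "subspace V" and p: "is_norm_on V p" and t: "t \<in> V"
  shows "t \<bullet> u \<le> conj_norm V p u * p t"
proof (cases "t = 0")
  case True
  then show ?thesis
    using is_norm_on_0[OF V p] by simp
next
  case False
  obtain m where m: "m > 0" "\<And>t. t \<in> V \<Longrightarrow> m * norm t \<le> p t"
    using norm_le_is_norm_on[OF V p] by blast
  have bdd: "bdd_above ((\<lambda>s. s \<bullet> u) ` {s \<in> V. p s \<le> 1})"
  proof (rule bdd_aboveI2)
    fix s assume "s \<in> {s \<in> V. p s \<le> 1}"
    then have "m * norm s \<le> 1"
      using m(2)[of s] by auto
    then have "norm s \<le> 1 / m"
      using m(1) by (simp add: field_simps)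
    then show "s \<bullet> u \<le> 1 / m * norm u"
      using norm_cauchy_schwarz[of s u] mult_right_mono[of "norm s" "1 / m" "norm u"] by simp
  qed
  have pt: "p t > 0"
    using p t False unfolding is_norm_on_def by (metis less_eq_real_def)
  then have "(1 / p t) *\<^sub>R t \<in> {s \<in> V. p s \<le> 1}"
    using p t V by (auto simp: is_norm_on_def subspace_scale)
  then have "(1 / p t) *\<^sub>R t \<bullet> u \<le> conj_norm V p u"
    unfolding conj_norm_def using bdd by (rule cSUP_upper)
  then show ?thesis
    using pt by (simp add: field_simps)
qed

text \<open>The descent lemma, by monotonicity instead of integration: subtracting the linear and
  quadratic terms from \<open>f\<close> along the segment from \<open>x\<close> to
  \<open>x + t\<close> leaves a function with nonpositive derivative.\<close>

lemma block_descent: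
  fixes f :: "real ^ 'd::finite \<Rightarrow> real"
  assumes gradient: "\<And>x. GDERIV f x :> g x"
    and lipschitz: "block_lipschitz_gradient n blk p L g"
    and p: "is_norm_on (block_space blk i) (p i)"
    and i: "i \<in> {1..n}" and t: "t \<in> block_space blk i"
  shows "f (x + t) \<le> f x + g x \<bullet> t + L i / 2 * (p i t)\<^sup>2"
proof -
  let ?V = "block_space blk i"
  define \<phi> where "\<phi> r = f (x + r *\<^sub>R t) - r * (g x \<bullet> t) - L i / 2 * (p i t)\<^sup>2 * r\<^sup>2" for r
  have deriv: "(\<phi> has_real_derivative (g (x + r *\<^sub>R t) \<bullet> t - g x \<bullet> t - L i * (p i t)\<^sup>2 * r)) (at r)" for r
  proof -
    have "(f has_derivative (\<lambda>h. h \<bullet> g (x + r *\<^sub>R t))) (at (x + r *\<^sub>R t))"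
      using gradient by (simp add: gderiv_def)
    moreover have "((\<lambda>r. x + r *\<^sub>R t) has_derivative (\<lambda>h. h *\<^sub>R t)) (at r)"
      by (auto intro!: derivative_eq_intros)
    ultimately have "((\<lambda>r. f (x + r *\<^sub>R t)) has_derivative (\<lambda>h. h *\<^sub>R t \<bullet> g (x + r *\<^sub>R t))) (at r)"
      by (rule has_derivative_compose[rotated])
    then have "((\<lambda>r. f (x + r *\<^sub>R t)) has_real_derivative (g (x + r *\<^sub>R t) \<bullet> t)) (at r)"
      by (simp add: has_field_derivative_def inner_commute mult_commute_abs)
    then show ?thesis
      unfolding \<phi>_def by (auto intro!: derivative_eq_intros)
  qed
  have nonpos: "g (x + r *\<^sub>R t) \<bullet> t - g x \<bullet> t - L i * (p i t)\<^sup>2 * r \<le> 0" if r: "0 \<le> r" for r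
  proof -
    have rt: "r *\<^sub>R t \<in> ?V"
      using t subspace_block_space by (rule subspace_scale[rotated])
    let ?u = "block_part blk i (g (x + r *\<^sub>R t)) - block_part blk i (g x)"
    \<comment> \<open>As \<open>t\<close> lies in block \<open>i\<close>, only that block of the
      gradient matters, and the block Lipschitz condition controls it.\<close>
    have "g (x + r *\<^sub>R t) \<bullet> t - g x \<bullet> t = t \<bullet> ?u"
      using inner_block_part_left[OF t] by (simp add: inner_diff_right inner_commute)
    also have "\<dots> \<le> conj_norm ?V (p i) ?u * p i t"
      using subspace_block_space p t by (rule inner_le_conj_norm)
    also have "\<dots> \<le> (L i * p i (r *\<^sub>R t)) * p i t"
    proof (rule mult_right_mono)
      show "conj_norm ?V (p i) ?u \<le> L i * p i (r *\<^sub>R t)"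
        using lipschitz i rt unfolding block_lipschitz_gradient_def by blast
      show "0 \<le> p i t"
        using p t by (simp add: is_norm_on_def)
    qed
    also have "\<dots> = L i * (p i t)\<^sup>2 * r"
      using p t r by (simp add: is_norm_on_def power2_eq_square)
    finally show ?thesis by simp
  qed
  have "\<phi> 1 \<le> \<phi> 0"
  proof (rule DERIV_nonpos_imp_nonincreasing[of 0 1 \<phi>])
    fix r :: real assume "0 \<le> r" "r \<le> 1"
    then show "\<exists>y. (\<phi> has_real_derivative y) (at r) \<and> y \<le> 0"
      using deriv nonpos by blast
  qed simp
  then show ?thesis
    by (simp add: \<phi>_def)
qed

section \<open>Averaging convex functions over samples\<close>

text \<open>Jensen's inequality with equal weights \<open>1 / card S\<close>. For empty
  \<open>S\<close> both sides are 0.\<close>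

lemma convex_on_average_le:
  fixes \<phi> :: "'b::real_vector \<Rightarrow> real"
  assumes \<phi>: "convex_on UNIV \<phi>" and S: "finite S"
  shows "\<phi> (x + (\<Sum>i\<in>S. v i)) - \<phi> x \<le>
    (\<Sum>i\<in>S. (\<phi> (x + real (card S) *\<^sub>R v i) - \<phi> x) / real (card S))"
proof (cases "S = {}")
  case False
  let ?k = "real (card S)"
  have k: "?k > 0"
    using S False by (simp add: card_gt_0_iff)
  have "\<phi> (\<Sum>i\<in>S. (1 / ?k) *\<^sub>R (x + ?k *\<^sub>R v i)) \<le> (\<Sum>i\<in>S. 1 / ?k * \<phi> (x + ?k *\<^sub>R v i))"
    using S False k \<phi> by (intro convex_on_sum) auto
  moreover have "(\<Sum>i\<in>S. (1 / ?k) *\<^sub>R (x + ?k *\<^sub>R v i)) = x + (\<Sum>i\<in>S. v i)"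
  proof -
    have "(\<Sum>i\<in>S. (1 / ?k) *\<^sub>R (x + ?k *\<^sub>R v i)) = (\<Sum>i\<in>S. (1 / ?k) *\<^sub>R x + v i)"
      using k by (intro sum.cong) (auto simp: scaleR_add_right)
    also have "\<dots> = ?k *\<^sub>R ((1 / ?k) *\<^sub>R x) + (\<Sum>i\<in>S. v i)"
      by (simp only: sum.distrib sum_constant_scaleR)
    finally show ?thesis
      using k by simp
  qed
  moreover have "(\<Sum>i\<in>S. (\<phi> (x + ?k *\<^sub>R v i) - \<phi> x) / ?k) = (\<Sum>i\<in>S. 1 / ?k * \<phi> (x + ?k *\<^sub>R v i)) - \<phi> x"
    using k by (simp add: diff_divide_distrib sum_subtractf)
  ultimately show ?thesis by simp
qed simp

context equipartition
begin

text \<open>The ESO inequality freed from the block structure: \<open>v i\<close> stands for block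
  \<open>i\<close> of \<open>h\<close>, and \<open>G i\<close> and \<open>Q i\<close> for the linear
  and quadratic coefficients that the descent inequality supplies in that direction.\<close>

lemma average_samples_le:
  fixes F :: "'j \<Rightarrow> 'b::real_vector \<Rightarrow> real" and v :: "'a \<Rightarrow> 'b"
  assumes convex: "\<And>J. J \<in> \<J> \<Longrightarrow> convex_on UNIV (F J)"
    and K: "\<And>J. J \<in> \<J> \<Longrightarrow> balanced \<xi> (K J)"
    and dep: "\<And>J i y k. J \<in> \<J> \<Longrightarrow> i \<in> (\<Union>c\<in>I. P c) - K J \<Longrightarrow> F J (y + k *\<^sub>R v i) = F J y"
    and f: "\<And>y. f y = (\<Sum>J\<in>\<J>. F J y)"
    and descent: "\<And>i k. i \<in> (\<Union>c\<in>I. P c) \<Longrightarrow> 0 < k \<Longrightarrow> f (x + k *\<^sub>R v i) \<le> f x + k * G i + k\<^sup>2 / 2 * Q i"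
    and xi: "1 \<le> \<xi>" "\<xi> \<le> s"
    and beta: "\<beta> = 1 + (real \<xi> - 1) * (real \<tau> - 1) / max 1 (real s - 1)
      + (real (card I) - 1) * (real \<xi> * real \<tau> / real s)"
  shows "(\<Sum>Z\<in>samples. f (x + (\<Sum>i\<in>Z. v i))) / real (card samples) \<le>
    f x + real \<tau> / real s * ((\<Sum>i\<in>(\<Union>c\<in>I. P c). G i) + \<beta> / 2 * (\<Sum>i\<in>(\<Union>c\<in>I. P c). Q i))"
proof -
  let ?U = "\<Union>c\<in>I. P c"
  define D where "D J i k = (F J (x + real k *\<^sub>R v i) - F J x) / real k" for J i k
  let ?S = "\<lambda>i. {Z\<in>samples. i \<in> Z}"
  have s: "real s > 0"
    using tau_ge_1 tau_le by simp
  \<comment> \<open>For each \<open>i\<close> a reference set \<open>B i\<close> is fixed,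
    independent of \<open>J\<close>. Replacing \<open>K J\<close> by it makes the step length the
    same for all \<open>J\<close>.\<close>
  have "\<exists>B. balanced \<xi> B \<and> {i} \<subseteq> B" if "i \<in> ?U" for i
  proof (rule balanced_extension)
    show "card (P c \<inter> {i}) \<le> \<xi>" for c
      using xi(1) card_mono[of "{i}" "P c \<inter> {i}"] by simp
  qed (use that xi in auto)
  then obtain B where B: "\<And>i. i \<in> ?U \<Longrightarrow> balanced \<xi> (B i) \<and> i \<in> B i"
    by (metis insert_subset)
  have drop: "F J (x + (\<Sum>i\<in>Z. v i)) = F J (x + (\<Sum>i\<in>Z \<inter> K J. v i))"
    if J: "J \<in> \<J>" and Z: "finite Z" "Z \<subseteq> ?U" for J Z
  proof -
    have "F J (y + (\<Sum>i\<in>A. v i)) = F J y" if "finite A" "A \<subseteq> ?U - K J" for A y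
      using that
    proof (induction A rule: finite_induct)
      case (insert a A)
      then have "F J ((y + (\<Sum>i\<in>A. v i)) + 1 *\<^sub>R v a) = F J (y + (\<Sum>i\<in>A. v i))"
        using J by (intro dep) auto
      then show ?case
        using insert by (simp add: add_ac)
    qed simp
    moreover have "(\<Sum>i\<in>Z. v i) = (\<Sum>i\<in>Z \<inter> K J. v i) + (\<Sum>i\<in>Z - K J. v i)"
      using Z(1) by (metis sum.Int_Diff)
    ultimately show ?thesis
      using Z by (metis Diff_mono add.assoc finite_Diff order_refl)
  qed
  have sumF: "F J (x + (\<Sum>i\<in>Z. v i)) - F J x \<le> (\<Sum>i\<in>?U. if i \<in> Z then D J i (card (Z \<inter> K J)) else 0)"
    if J: "J \<in> \<J>" and Z: "Z \<in> samples" for J Z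
  proof -
    have fin: "finite Z" and sub: "Z \<subseteq> ?U"
      using Z finite_sample[OF Z] by (simp_all add: samples_def)
    have "F J (x + (\<Sum>i\<in>Z. v i)) - F J x \<le> (\<Sum>i\<in>Z \<inter> K J. D J i (card (Z \<inter> K J)))"
      unfolding D_def drop[OF J fin sub] using convex[OF J] fin
      by (intro convex_on_average_le finite_Int disjI1)
    also have "\<dots> = (\<Sum>i\<in>?U. if i \<in> Z then D J i (card (Z \<inter> K J)) else 0)"
      \<comment> \<open>The sum may run over the whole ground set because \<open>D J i\<close>
        vanishes for \<open>i\<close> outside \<open>K J\<close>.\<close>
      using sub finite_ground J by (intro sum.mono_neutral_cong_left) (auto simp: D_def dep)
    finally show ?thesis .
  qed
  have swap: "(\<Sum>Z\<in>samples. \<Sum>i\<in>?U. if i \<in> Z then D J i (card (Z \<inter> K J)) else 0) =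
      (\<Sum>i\<in>?U. \<Sum>Z\<in>?S i. D J i (card (Z \<inter> B i)))" if J: "J \<in> \<J>" for J
  proof -
    have "(\<Sum>Z\<in>samples. \<Sum>i\<in>?U. if i \<in> Z then D J i (card (Z \<inter> K J)) else 0) =
        (\<Sum>i\<in>?U. \<Sum>Z\<in>samples. if i \<in> Z then D J i (card (Z \<inter> K J)) else 0)"
      by (rule sum.swap)
    also have "\<dots> = (\<Sum>i\<in>?U. \<Sum>Z\<in>?S i. D J i (card (Z \<inter> K J)))"
      using finite_samples by (intro sum.cong refl sum.inter_filter[symmetric])
    also have "\<dots> = (\<Sum>i\<in>?U. \<Sum>Z\<in>?S i. D J i (card (Z \<inter> B i)))"
    proof (rule sum.cong)
      fix i assume i: "i \<in> ?U"
      show "(\<Sum>Z\<in>?S i. D J i (card (Z \<inter> K J))) = (\<Sum>Z\<in>?S i. D J i (card (Z \<inter> B i)))"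
      proof (cases "i \<in> K J")
        case True
        then show ?thesis
          using K[OF J] B[OF i] by (intro sum_balanced_eq) auto
      next
        case False
        then have "D J i k = 0" for k
          using dep[OF J, of i] i by (simp add: D_def)
        then show ?thesis by simp
      qed
    qed simp
    finally show ?thesis .
  qed
  have "(\<Sum>Z\<in>samples. f (x + (\<Sum>i\<in>Z. v i)) - f x) =
      (\<Sum>Z\<in>samples. \<Sum>J\<in>\<J>. F J (x + (\<Sum>i\<in>Z. v i)) - F J x)"
    by (simp add: f sum_subtractf)
  also have "\<dots> \<le> (\<Sum>Z\<in>samples. \<Sum>J\<in>\<J>. \<Sum>i\<in>?U. if i \<in> Z then D J i (card (Z \<inter> K J)) else 0)"
    by (intro sum_mono sumF)
  also have "\<dots> = (\<Sum>J\<in>\<J>. \<Sum>Z\<in>samples. \<Sum>i\<in>?U. if i \<in> Z then D J i (card (Z \<inter> K J)) else 0)"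
    by (rule sum.swap)
  also have "\<dots> = (\<Sum>J\<in>\<J>. \<Sum>i\<in>?U. \<Sum>Z\<in>?S i. D J i (card (Z \<inter> B i)))"
    by (intro sum.cong refl swap)
  also have "\<dots> = (\<Sum>i\<in>?U. \<Sum>Z\<in>?S i. \<Sum>J\<in>\<J>. D J i (card (Z \<inter> B i)))"
    by (subst sum.swap) (intro sum.cong refl sum.swap)
  \<comment> \<open>With the sum over \<open>J\<close> innermost and a common step length, the
    quotients of the \<open>F J\<close> add up to that of \<open>f\<close>. Dividing the descent
    inequality by the step length leaves a term linear in \<open>card (Z \<inter> B i)\<close>,
    whose sum over the samples containing \<open>i\<close> is known.\<close>
  also have "\<dots> \<le> (\<Sum>i\<in>?U. \<Sum>Z\<in>?S i. G i + Q i / 2 * real (card (Z \<inter> B i)))"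
  proof (intro sum_mono)
    fix i Z assume i: "i \<in> ?U" and Z: "Z \<in> ?S i"
    let ?k = "card (Z \<inter> B i)"
    have "i \<in> Z \<inter> B i" "finite (Z \<inter> B i)"
      using B[OF i] Z finite_sample by auto
    then have k: "real ?k > 0"
      by (auto simp: card_gt_0_iff)
    have "(\<Sum>J\<in>\<J>. D J i ?k) = (f (x + real ?k *\<^sub>R v i) - f x) / real ?k"
      by (simp add: D_def f sum_subtractf flip: sum_divide_distrib)
    also have "\<dots> \<le> (real ?k * G i + (real ?k)\<^sup>2 / 2 * Q i) / real ?k"
      using descent[OF i k] k by (intro divide_right_mono) auto
    also have "\<dots> = G i + Q i / 2 * real ?k"
      using k by (simp add: field_simps power2_eq_square)
    finally show "(\<Sum>J\<in>\<J>. D J i ?k) \<le> G i + Q i / 2 * real ?k" .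
  qed
  also have "\<dots> = (\<Sum>i\<in>?U. real \<tau> / real s * real (card samples) * (G i + \<beta> / 2 * Q i))"
  proof (rule sum.cong)
    fix i assume i: "i \<in> ?U"
    then have N: "real (card (?S i)) = real \<tau> / real s * real (card samples)"
      using card_containing[of _ i] s by (auto simp: field_simps)
    have "(\<Sum>Z\<in>?S i. G i + Q i / 2 * real (card (Z \<inter> B i))) =
        real (card (?S i)) * G i + Q i / 2 * (\<Sum>Z\<in>?S i. real (card (Z \<inter> B i)))"
      by (simp add: sum.distrib sum_distrib_left)
    also have "(\<Sum>Z\<in>?S i. real (card (Z \<inter> B i))) = \<beta> * real (card (?S i))"
      unfolding beta using B[OF i] by (intro sum_card_Int_balanced) auto
    finally show "(\<Sum>Z\<in>?S i. G i + Q i / 2 * real (card (Z \<inter> B i))) =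
        real \<tau> / real s * real (card samples) * (G i + \<beta> / 2 * Q i)"
      unfolding N using s by (simp add: field_simps)
  qed simp
  also have "\<dots> = real (card samples) * (real \<tau> / real s * (sum G ?U + \<beta> / 2 * sum Q ?U))"
    by (simp only: sum_distrib_left[symmetric] sum.distrib) (simp add: mult_ac)
  finally have "(\<Sum>Z\<in>samples. f (x + (\<Sum>i\<in>Z. v i))) \<le>
      real (card samples) * (f x + real \<tau> / real s * (sum G ?U + \<beta> / 2 * sum Q ?U))"
    by (simp add: sum_subtractf algebra_simps)
  moreover have "real (card samples) > 0"
    using finite_samples samples_nonempty by (simp add: card_gt_0_iff)
  ultimately show ?thesis
    by (simp add: divide_le_eq mult.commute)
qed

end

text \<open>The case \<open>\<xi> = 0\<close> occurs when every \<open>J\<close> is empty. Then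
  \<beta> is 0 if \<open>\<tau> = s\<close> and \<open>s \<ge> 2\<close>, so the ESO, which demands
  a positive \<beta>, is claimed only for \<open>1 \<le> \<xi>\<close>, while the inequality is
  claimed always.\<close>

theorem theorem4:
  fixes n C s \<tau> \<xi> :: nat
    and blk :: "'d::finite \<Rightarrow> nat"
    and p :: "nat \<Rightarrow> real ^ 'd \<Rightarrow> real"
    and f :: "real ^ 'd \<Rightarrow> real"
    and g :: "real ^ 'd \<Rightarrow> real ^ 'd"
    and F :: "nat set \<Rightarrow> real ^ 'd \<Rightarrow> real"
    and \<J> :: "nat set set"
    and L :: "nat \<Rightarrow> real"
    and P :: "nat \<Rightarrow> nat set"
    and \<beta> :: real
  assumes blocks: "range blk \<subseteq> {1..n}"
    and norms: "\<And>i. i \<in> {1..n} \<Longrightarrow> is_norm_on (block_space blk i) (p i)"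
    and J_subsets: "\<J> \<subseteq> Pow {1..n}"
    and J_nonempty: "\<J> \<noteq> {}"
    and f_sum: "\<And>x. f x = (\<Sum>J\<in>\<J>. F J x)"
    and F_convex: "\<And>J. J \<in> \<J> \<Longrightarrow> convex_on UNIV (F J)"
    and F_depends: "\<And>J. J \<in> \<J> \<Longrightarrow> depends_only_on_blocks blk J (F J)"
    and gradient: "\<And>x. GDERIV f x :> g x"
    and L_pos: "\<And>i. i \<in> {1..n} \<Longrightarrow> 0 < L i"
    and lipschitz: "block_lipschitz_gradient n blk p L g"
    and C_pos: "1 \<le> C"
    and partition: "balanced_partition n C s P"
    and tau: "\<tau> \<in> {1..s}"
    and xi: "\<xi> = Max {card (P c \<inter> J) |c J. c \<in> {1..C} \<and> J \<in> \<J>}"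
    and beta: "\<beta> = 1 + (real \<xi> - 1) * (real \<tau> - 1) / max 1 (real s - 1)
                   + (real C - 1) * (real \<xi> * real \<tau> / real s)"
  shows "(1 \<le> \<xi> \<longrightarrow> admits_ESO n blk p f g (distributed_sampling C \<tau> P) \<beta> L) \<and>
    (\<forall>x h. measure_pmf.expectation (distributed_sampling C \<tau> P)
               (\<lambda>S. f (x + restrict_blocks blk S h))
        \<le> f x + measure_pmf.expectation (distributed_sampling C \<tau> P) (\<lambda>S. real (card S)) / real n
              * (g x \<bullet> h + \<beta> / 2 * (weighted_norm n blk p L h)\<^sup>2))"
proof -
  have disj: "disjoint_family_on P {1..C}" and U: "(\<Union>c\<in>{1..C}. P c) = {1..n}"
    and cardP: "\<And>c. c \<in> {1..C} \<Longrightarrow> card (P c) = s" and sn: "real s = real n / real C"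
    using partition by (auto simp: balanced_partition_def)
  interpret equipartition "{1..C}" P s \<tau>
  proof
    show "finite (P c)" if "c \<in> {1..C}" for c
      using that U by (metis UN_upper finite_atLeastAtMost finite_subset)
  qed (use disj cardP tau in auto)
  have s: "1 \<le> s"
    using tau by simp
  have nC: "real n = real s * real C"
    using sn C_pos by simp
  let ?E = "measure_pmf.expectation (distributed_sampling C \<tau> P)"
  have law: "distributed_sampling C \<tau> P = pmf_of_set samples"
    unfolding distributed_sampling_def by (rule Pi_pmf_union_eq)
  have E: "?E u = (\<Sum>Z\<in>samples. u Z) / real (card samples)" for u :: "nat set \<Rightarrow> real"
    unfolding law using samples_nonempty finite_samples by (rule integral_pmf_of_set)
  have samples_pos: "real (card samples) > 0"
    using finite_samples samples_nonempty by (simp add: card_gt_0_iff)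
  \<comment> \<open>Every sample has exactly \<open>C * \<tau>\<close> points, and
    \<open>n = s * C\<close>.\<close>
  have size: "?E (\<lambda>S. real (card S)) / real n = real \<tau> / real s"
    using card_sample samples_pos C_pos s by (simp add: E nC field_simps)
  have finJ: "finite \<J>"
    using J_subsets by (rule finite_subset) simp
  let ?A = "{card (P c \<inter> J) |c J. c \<in> {1..C} \<and> J \<in> \<J>}"
  have "?A = (\<lambda>(c, J). card (P c \<inter> J)) ` ({1..C} \<times> \<J>)"
    by fast
  then have finA: "finite ?A"
    using finJ by simp
  have xi_ge: "card (P c \<inter> J) \<le> \<xi>" if "c \<in> {1..C}" "J \<in> \<J>" for c J
    unfolding xi using finA that by (intro Max_ge) blast+
  have xi_le: "\<xi> \<le> s"
  proof -
    have "1 \<in> {1..C}"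
      using C_pos by simp
    then have "?A \<noteq> {}"
      using J_nonempty by blast
    then have "\<xi> \<in> ?A"
      unfolding xi by (rule Max_in[OF finA])
    then obtain c J where "c \<in> {1..C}" "\<xi> = card (P c \<inter> J)"
      by blast
    then show ?thesis
      using card_mono[OF finite_P, of c "P c \<inter> J"] cardP by simp
  qed
  \<comment> \<open>Nonnegativity is what the case \<open>\<xi> = 0\<close> needs: there the
    quotient in \<beta> may be negative, but not below -1.\<close>
  have beta_nonneg: "0 \<le> \<beta>"
  proof -
    have "(1 - real \<xi>) * (real \<tau> - 1) \<le> 1 * max 1 (real s - 1)"
      using tau by (intro mult_mono) auto
    then have "- 1 \<le> (real \<xi> - 1) * (real \<tau> - 1) / max 1 (real s - 1)"
      by (simp add: field_simps max_def split: if_splits)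
    moreover have "0 \<le> (real C - 1) * (real \<xi> * real \<tau> / real s)"
      using C_pos by simp
    ultimately show ?thesis
      unfolding beta by linarith
  qed
  have wnorm: "(weighted_norm n blk p L h)\<^sup>2 = (\<Sum>i=1..n. L i * (p i (block_part blk i h))\<^sup>2)" for h
    unfolding weighted_norm_def using L_pos by (intro real_sqrt_pow2 sum_nonneg) (simp add: less_imp_le)
  have part_part: "block_part blk i (block_part blk j h) = (if i = j then block_part blk i h else 0)" for i j h
    by (auto simp: block_part_def vec_eq_iff)
  have part_add: "block_part blk i (y + k *\<^sub>R z) = block_part blk i y + k *\<^sub>R block_part blk i z" for i y k z
    by (simp add: block_part_def vec_eq_iff)
  have sum_parts: "(\<Sum>i=1..n. block_part blk i h) = h" for h
  proof -
    have "blk k \<in> {1..n}" for k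
      using blocks by blast
    then show ?thesis
      by (simp add: block_part_def vec_eq_iff)
  qed
  have main: "?E (\<lambda>S. f (x + restrict_blocks blk S h)) \<le>
      f x + ?E (\<lambda>S. real (card S)) / real n * (g x \<bullet> h + \<beta> / 2 * (weighted_norm n blk p L h)\<^sup>2)" for x h
  proof (cases "1 \<le> \<xi>")
    case True
    let ?v = "\<lambda>i. block_part blk i h"
    have "\<exists>K. balanced \<xi> K \<and> J \<subseteq> K" if "J \<in> \<J>" for J
      using J_subsets that U xi_ge xi_le by (intro balanced_extension) auto
    then obtain K where K: "\<And>J. J \<in> \<J> \<Longrightarrow> balanced \<xi> (K J) \<and> J \<subseteq> K J"
      by metis
    have "(\<Sum>Z\<in>samples. f (x + (\<Sum>i\<in>Z. ?v i))) / real (card samples) \<le>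
        f x + real \<tau> / real s * ((\<Sum>i\<in>(\<Union>c\<in>{1..C}. P c). g x \<bullet> ?v i)
          + \<beta> / 2 * (\<Sum>i\<in>(\<Union>c\<in>{1..C}. P c). L i * (p i (?v i))\<^sup>2))"
    proof (rule average_samples_le[OF F_convex])
      show "balanced \<xi> (K J)" if "J \<in> \<J>" for J
        using K that by blast
      show "F J (y + k *\<^sub>R ?v i) = F J y" if "J \<in> \<J>" "i \<in> (\<Union>c\<in>{1..C}. P c) - K J" for J i y k
      proof -
        \<comment> \<open>Since \<open>J \<subseteq> K J\<close>, the index \<open>i\<close> is not
          in \<open>J\<close>, and a move in block \<open>i\<close> leaves the blocks in
          \<open>J\<close> unchanged.\<close>
        have "block_part blk j (y + k *\<^sub>R ?v i) = block_part blk j y" if "j \<in> J" for j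
          using K[OF \<open>J \<in> \<J>\<close>] \<open>i \<in> _\<close> that by (auto simp: part_add part_part)
        then show ?thesis
          using F_depends[OF \<open>J \<in> \<J>\<close>] unfolding depends_only_on_blocks_def by blast
      qed
      show "f (x + k *\<^sub>R ?v i) \<le> f x + k * (g x \<bullet> ?v i) + k\<^sup>2 / 2 * (L i * (p i (?v i))\<^sup>2)"
        if "i \<in> (\<Union>c\<in>{1..C}. P c)" "0 < k" for i k
      proof -
        have i: "i \<in> {1..n}"
          using that(1) unfolding U .
        have "k *\<^sub>R ?v i \<in> block_space blk i"
          using subspace_block_space block_part_in_block_space by (rule subspace_scale)
        then have "f (x + k *\<^sub>R ?v i) \<le> f x + g x \<bullet> (k *\<^sub>R ?v i) + L i / 2 * (p i (k *\<^sub>R ?v i))\<^sup>2"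
          using block_descent[OF gradient lipschitz norms[OF i] i] by blast
        moreover have "p i (k *\<^sub>R ?v i) = \<bar>k\<bar> * p i (?v i)"
          using norms[OF i] block_part_in_block_space[of blk i h] by (simp add: is_norm_on_def)
        ultimately show ?thesis
          by (simp add: power_mult_distrib mult_ac)
      qed
    qed (use f_sum True xi_le beta in auto)
    then show ?thesis
      unfolding size unfolding E restrict_blocks_def wnorm U inner_sum_right[symmetric] sum_parts .
  next
    case False
    \<comment> \<open>With \<open>\<xi> = 0\<close> all \<open>J\<close> are empty, so
      \<open>f\<close> is constant and its gradient is 0. The claim reduces to the nonnegativity of
      the quadratic term.\<close>
    have const: "F J y = F J z" if J: "J \<in> \<J>" for J y z
    proof -
      have "P c \<inter> J = {}" if "c \<in> {1..C}" for c
        using xi_ge[OF that J] False finite_P[OF that] by (auto simp: not_le)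
      then have "(\<Union>c\<in>{1..C}. P c) \<inter> J = {}"
        by blast
      then have "J = {}"
        unfolding U using J_subsets J by blast
      then show ?thesis
        using F_depends[OF J] by (simp add: depends_only_on_blocks_def)
    qed
    then have f_const: "f y = f x" for y
      unfolding f_sum by (rule sum.cong[OF refl])
    have eq: "f = (\<lambda>_. f x)"
      by (rule ext) (rule f_const)
    have "((\<lambda>_. f x) has_derivative (\<lambda>_. 0)) (at x)"
      by (rule has_derivative_const)
    then have "(f has_derivative (\<lambda>_. 0)) (at x)"
      by (simp only: eq[symmetric])
    moreover have "(f has_derivative (\<lambda>h. h \<bullet> g x)) (at x)"
      using gradient[of x] by (simp only: gderiv_def)
    ultimately have "(\<lambda>h. h \<bullet> g x) = (\<lambda>_. 0)"
      by (rule has_derivative_unique[rotated])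
    then have "g x \<bullet> h = 0"
      by (metis inner_commute)
    moreover have "?E (\<lambda>S. f (x + restrict_blocks blk S h)) = f x"
      unfolding E f_const[of "x + _"] using samples_pos by simp
    ultimately show ?thesis
      unfolding size using beta_nonneg by simp
  qed
  have "0 < \<beta>" if "1 \<le> \<xi>"
  proof -
    have "0 \<le> (real \<xi> - 1) * (real \<tau> - 1) / max 1 (real s - 1)"
      using that tau by simp
    moreover have "0 \<le> (real C - 1) * (real \<xi> * real \<tau> / real s)"
      using C_pos by simp
    ultimately show ?thesis
      unfolding beta by linarith
  qed
  then show ?thesis
    using main L_pos unfolding admits_ESO_def by blast
qed

end
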